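(* Let $\alpha\in\mathbb{R}$ with $|\alpha|\le 2/\sqrt{17}$ be arbitrary, let $T\colon \ell^2\to\ell^2$ be the operator defined in the context, and set $B:=\mathrm{Id}+\alpha T$. For $m\in\mathbb{N}$ let $B_m\colon\ell^2\to\ell^2$ be the maximally monotone operator $$B_m(x):=m\,B(x/m)=x+\alpha m\,T(x/m).$$ Then the graphical limit of $B_m$ as $m\to\infty$ is the operator $Z\colon\ell^2\rightrightarrows\ell^2$ defined via $\operatorname{graph}(Z)=\{(0,0)\}$.
   Context: $\mathbb{N}=\{1,2,3,\dots\}$. $\ell^2$ is the real Hilbert space of square-summable sequences with canonical orthonormal basis $(e_n)_{n\ge 1}$. For $n\in\mathbb{N}$ define $f_n\colon[0,\infty)\to\mathbb{R}$ by $f_n(t)=0$ if $t\le 2^{-n-1}$ or $t\ge 2^{-n+2}$; $f_n(t)=2(t-2^{-n-1})$ if $2^{-n-1}\le t\le 2^{-n}$; $f_n(t)=2^{-n}$ if $2^{-n}\le t\le 2^{-n+1}$; $f_n(t)=\tfrac12(2^{-n+2}-t)$ if $2^{-n+1}\le t\le 2^{-n+2}$. Define $T\colon\ell^2\to\ell^2$ by $T(x):=\sum_{n=1}^\infty f_n(\|x\|)\,e_n$; for each $x$ at most three terms of the sum are nonzero. For a set-valued operator $A\colon H\rightrightarrows H$ on a real Hilbert space $H$, $\operatorname{graph}(A)=\{(x,y)\in H\times H: y\in A(x)\}$; single-valued maps are identified with set-valued operators. $A$ is monotone if $\langle y_1-y_2,x_1-x_2\rangle\ge 0$ for all $(x_1,y_1),(x_2,y_2)\in\operatorname{graph}(A)$,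 and maximally monotone if moreover its graph is not properly contained in the graph of another monotone operator. For operators $A_m\colon H\rightrightarrows H$, the outer limit $\limsup_{m\to\infty}\operatorname{graph}(A_m)$ is the set of all $(x,y)\in H\times H$ for which there are a strictly increasing sequence $(m_k)_k$ and points $(x_{m_k},y_{m_k})\in\operatorname{graph}(A_{m_k})$ with $x_{m_k}\to x$, $y_{m_k}\to y$ in norm; the inner limit $\liminf_{m\to\infty}\operatorname{graph}(A_m)$ is the set of all $(x,y)$ for which there are $(x_m,y_m)\in\operatorname{graph}(A_m)$ (for all sufficiently large $m$) with $x_m\to x$, $y_m\to y$ in norm. An operator $A$ is the graphical limit of $A_m$ as $m\to\infty$ if $\operatorname{graph}(A)$ equals both the outer and the inner limit.
   Formalization: The case α = 0 is excluded: there B_m = Id for every m, so the graphical limit is Id rather than Z and the claim fails; all other α with |α| ≤ 2/√17 are covered. *)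

theory Defs
  imports "HOL-Analysis.Analysis"
begin

text \<open>The real Hilbert space of square-summable sequences. Coordinates are numbered from 0,
  so the coordinate that is usually numbered n (n = 1, 2, ...) is the one at position n - 1.\<close>

typedef ell2 = "{x :: nat \<Rightarrow> real. summable (\<lambda>n. (x n)\<^sup>2)}"
  morphisms coord Abs_ell2
  by (rule exI[of _ "\<lambda>_. 0"]) simp

lemma summable_coord_sq: "summable (\<lambda>n. (coord x n)\<^sup>2)"
  using coord[of x] by simp

lemma ell2_eqI: "(\<And>n. coord x n = coord y n) \<Longrightarrow> x = y"
  by (metis coord_inject ext)

lemma summable_sq_add:
  fixes a b :: "nat \<Rightarrow> real"
  assumes "summable (\<lambda>n. (a n)\<^sup>2)" "summable (\<lambda>n. (b n)\<^sup>2)"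
  shows "summable (\<lambda>n. (a n + b n)\<^sup>2)"
proof (rule summable_comparison_test)
  show "summable (\<lambda>n. 2 * (a n)\<^sup>2 + 2 * (b n)\<^sup>2)"
    using assms by (intro summable_add summable_mult)
  have "(u + v)\<^sup>2 \<le> 2 * u\<^sup>2 + 2 * v\<^sup>2" for u v :: real
    using zero_le_power2[of "u - v"] by (simp add: power2_eq_square algebra_simps)
  then show "\<exists>N. \<forall>n\<ge>N. norm ((a n + b n)\<^sup>2) \<le> 2 * (a n)\<^sup>2 + 2 * (b n)\<^sup>2"
    by simp
qed

lemma summable_sq_cmult:
  fixes a :: "nat \<Rightarrow> real"
  assumes "summable (\<lambda>n. (a n)\<^sup>2)"
  shows "summable (\<lambda>n. (c * a n)\<^sup>2)"
  using summable_mult[OF assms, of "c\<^sup>2"] by (simp add: power_mult_distrib)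

lemma summable_coord_mult: "summable (\<lambda>n. coord x n * coord y n)"
proof (rule summable_comparison_test)
  show "summable (\<lambda>n. (coord x n)\<^sup>2 + (coord y n)\<^sup>2)"
    by (intro summable_add summable_coord_sq)
  have "\<bar>u * v\<bar> \<le> u\<^sup>2 + v\<^sup>2" for u v :: real
    using zero_le_power2[of "\<bar>u\<bar> - \<bar>v\<bar>"] abs_ge_zero[of "u * v"]
    unfolding power2_diff power2_abs abs_mult by linarith
  then show "\<exists>N. \<forall>n\<ge>N. norm (coord x n * coord y n) \<le> (coord x n)\<^sup>2 + (coord y n)\<^sup>2"
    by simp
qed

instantiation ell2 :: real_inner
begin

definition "0 = Abs_ell2 (\<lambda>_. 0)"
definition "x + y = Abs_ell2 (\<lambda>n. coord x n + coord y n)"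
definition "- x = Abs_ell2 (\<lambda>n. - coord x n)"
definition "x - y = Abs_ell2 (\<lambda>n. coord x n - coord y n)"
definition "r *\<^sub>R x = Abs_ell2 (\<lambda>n. r * coord x n)"
definition "inner x y = (\<Sum>n. coord x n * coord y n)"
definition "norm x = sqrt (inner x (x :: ell2))"
definition "dist x y = norm (x - y :: ell2)"
definition "sgn x = inverse (norm x) *\<^sub>R (x :: ell2)"
definition "(uniformity :: (ell2 \<times> ell2) filter) =
  (INF e\<in>{0 <..}. principal {(x, y). dist x y < e})"
definition "open U = (\<forall>x\<in>U. eventually (\<lambda>(x', y). x' = x \<longrightarrow> y \<in> U)
  (uniformity :: (ell2 \<times> ell2) filter))" for U :: "ell2 set"

lemma coord_zero [simp]: "coord 0 n = 0"
  by (simp add: zero_ell2_def Abs_ell2_inverse)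

lemma coord_add [simp]: "coord (x + y) n = coord x n + coord y n"
  by (simp add: plus_ell2_def Abs_ell2_inverse summable_sq_add summable_coord_sq)

lemma coord_uminus [simp]: "coord (- x) n = - coord x n"
  by (simp add: uminus_ell2_def Abs_ell2_inverse summable_coord_sq)

lemma coord_diff [simp]: "coord (x - y) n = coord x n - coord y n"
  using summable_sq_add[OF summable_coord_sq[of x] summable_coord_sq[of "- y"]]
  by (simp add: minus_ell2_def Abs_ell2_inverse)

lemma coord_scaleR [simp]: "coord (r *\<^sub>R x) n = r * coord x n"
  by (simp add: scaleR_ell2_def Abs_ell2_inverse summable_sq_cmult summable_coord_sq)

instance
proof
  fix x y z :: ell2 and r s :: real
  show "x + y + z = x + (y + z)" "x + y = y + x" "0 + x = x" "- x + x = 0" "x - y = x + - y"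
    by (rule ell2_eqI; simp)+
  show "r *\<^sub>R (x + y) = r *\<^sub>R x + r *\<^sub>R y" "(r + s) *\<^sub>R x = r *\<^sub>R x + s *\<^sub>R x"
    "r *\<^sub>R s *\<^sub>R x = (r * s) *\<^sub>R x" "1 *\<^sub>R x = x"
    by (rule ell2_eqI; simp add: algebra_simps)+
  show "dist x y = norm (x - y)" by (rule dist_ell2_def)
  show "sgn x = inverse (norm x) *\<^sub>R x" by (rule sgn_ell2_def)
  show "(uniformity :: (ell2 \<times> ell2) filter) =
      (INF e\<in>{0 <..}. principal {(x, y). dist x y < e})" by (rule uniformity_ell2_def)
  show "open U = (\<forall>x\<in>U. \<forall>\<^sub>F (x', y) in uniformity. x' = x \<longrightarrow> y \<in> U)" for U :: "ell2 set"
    by (rule open_ell2_def)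
  show "inner x y = inner y x" by (simp add: inner_ell2_def mult.commute)
  show "inner (x + y) z = inner x z + inner y z"
    by (simp add: inner_ell2_def distrib_right suminf_add summable_coord_mult)
  show "inner (r *\<^sub>R x) y = r * inner x y"
    by (simp add: inner_ell2_def mult.assoc suminf_mult summable_coord_mult)
  show "0 \<le> inner x x"
    by (simp add: inner_ell2_def suminf_nonneg summable_coord_mult)
  show "inner x x = 0 \<longleftrightarrow> x = 0"
  proof
    assume "inner x x = 0"
    then have "\<forall>n. coord x n * coord x n = 0"
      by (subst suminf_eq_zero_iff[symmetric]) (auto simp: inner_ell2_def summable_coord_mult)
    then show "x = 0" by (intro ell2_eqI) simp
  qed (simp add: inner_ell2_def)
  show "norm x = sqrt (inner x x)" by (rule norm_ell2_def)
qed

end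

lemma norm_ell2_sq: "(norm x)\<^sup>2 = (\<Sum>n. (coord x n)\<^sup>2)"
  unfolding power2_norm_eq_inner inner_ell2_def by (simp add: power2_eq_square)

lemma sum_coord_sq_le: "(\<Sum>n<N. (coord x n)\<^sup>2) \<le> (norm x)\<^sup>2"
  unfolding norm_ell2_sq by (rule sum_le_suminf[OF summable_coord_sq]) auto

lemma abs_coord_le_norm: "\<bar>coord x n\<bar> \<le> norm x"
proof -
  have "(coord x n)\<^sup>2 \<le> (\<Sum>k<Suc n. (coord x k)\<^sup>2)" by (simp add: sum_nonneg)
  then have "(coord x n)\<^sup>2 \<le> (norm x)\<^sup>2" using sum_coord_sq_le[where x=x and N="Suc n"] by linarith
  then show ?thesis using abs_le_square_iff[of "coord x n" "norm x"] by simp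
qed

instance ell2 :: complete_space
proof
  fix X :: "nat \<Rightarrow> ell2"
  assume X: "Cauchy X"
  have "Cauchy (\<lambda>k. coord (X k) n)" for n
    unfolding Cauchy_iff
  proof (intro allI impI)
    fix e :: real assume "e > 0"
    then obtain M where M: "\<forall>i\<ge>M. \<forall>j\<ge>M. norm (X i - X j) < e"
      using X unfolding Cauchy_iff by blast
    have "norm (coord (X i) n - coord (X j) n) < e" if "i \<ge> M" "j \<ge> M" for i j
      using abs_coord_le_norm[of "X i - X j" n] M that by fastforce
    then show "\<exists>M. \<forall>i\<ge>M. \<forall>j\<ge>M. norm (coord (X i) n - coord (X j) n) < e" by blast
  qed
  then have "\<forall>n. \<exists>l. (\<lambda>k. coord (X k) n) \<longlonglongrightarrow> l"
    using Cauchy_convergent unfolding convergent_def by blast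
  then obtain l where l: "\<And>n. (\<lambda>k. coord (X k) n) \<longlonglongrightarrow> l n" by metis
  have bound: "(\<Sum>n<N. (coord (X i) n - l n)\<^sup>2) \<le> c\<^sup>2"
    if less: "\<And>j. j \<ge> M \<Longrightarrow> norm (X i - X j) < c" for i N M c
  proof (rule LIMSEQ_le_const2)
    show "(\<lambda>j. \<Sum>n<N. (coord (X i) n - coord (X j) n)\<^sup>2) \<longlonglongrightarrow> (\<Sum>n<N. (coord (X i) n - l n)\<^sup>2)"
      by (intro tendsto_intros l)
    have "(\<Sum>n<N. (coord (X i) n - coord (X j) n)\<^sup>2) \<le> c\<^sup>2" if "j \<ge> M" for j
    proof -
      have "(norm (X i - X j))\<^sup>2 \<le> c\<^sup>2"
        using less[OF that] by (intro power_mono) auto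
      then show ?thesis using sum_coord_sq_le[where N=N and x="X i - X j"] by simp
    qed
    then show "\<exists>K. \<forall>j\<ge>K. (\<Sum>n<N. (coord (X i) n - coord (X j) n)\<^sup>2) \<le> c\<^sup>2" by blast
  qed
  have smb: "summable (\<lambda>n. (coord (X i) n - l n)\<^sup>2) \<and> (\<Sum>n. (coord (X i) n - l n)\<^sup>2) \<le> c\<^sup>2"
    if "\<And>j. j \<ge> M \<Longrightarrow> norm (X i - X j) < c" for i M c
  proof -
    have *: "(\<Sum>n<N. (coord (X i) n - l n)\<^sup>2) \<le> c\<^sup>2" for N
      by (rule bound[OF that])
    have "summable (\<lambda>n. (coord (X i) n - l n)\<^sup>2)"
      by (rule summableI_nonneg_bounded[OF _ *]) simp
    then show ?thesis using suminf_le_const[OF _ *] by simp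
  qed
  obtain M1 where M1: "\<forall>i\<ge>M1. \<forall>j\<ge>M1. norm (X i - X j) < 1"
    using X[unfolded Cauchy_iff, rule_format, of 1] by auto
  have "summable (\<lambda>n. (coord (X M1) n - l n)\<^sup>2)" using smb[of M1 M1 1] M1 by blast
  then have "summable (\<lambda>n. (coord (X M1) n + (-1) * (coord (X M1) n - l n))\<^sup>2)"
    by (intro summable_sq_add summable_sq_cmult summable_coord_sq)
  then have suml: "summable (\<lambda>n. (l n)\<^sup>2)" by simp
  have cL: "coord (Abs_ell2 l) = l" by (simp add: Abs_ell2_inverse suml)
  have "X \<longlonglongrightarrow> Abs_ell2 l"
  proof (rule LIMSEQ_I)
    fix r :: real assume r: "r > 0"
    then obtain M where M: "\<forall>i\<ge>M. \<forall>j\<ge>M. norm (X i - X j) < r / 2"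
      using X[unfolded Cauchy_iff, rule_format, of "r / 2"] by auto
    have "norm (X i - Abs_ell2 l) < r" if "i \<ge> M" for i
    proof -
      have "(norm (X i - Abs_ell2 l))\<^sup>2 \<le> (r / 2)\<^sup>2"
        using smb[of M i "r / 2"] M that by (simp add: norm_ell2_sq cL)
      then have "norm (X i - Abs_ell2 l) \<le> r / 2"
        by (rule power2_le_imp_le) (use r in simp)
      then show ?thesis using r by linarith
    qed
    then show "\<exists>no. \<forall>n\<ge>no. norm (X n - Abs_ell2 l) < r" by blast
  qed
  then show "convergent X" unfolding convergent_def by blast
qed

instance ell2 :: banach ..

text \<open>The canonical orthonormal basis, numbered from 1: \<open>ell2_basis n\<close> is meant for n at least 1.\<close>

definition ell2_basis :: "nat \<Rightarrow> ell2" where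
  "ell2_basis n = Abs_ell2 (\<lambda>k. if k + 1 = n then 1 else 0)"

lemma coord_ell2_basis: "coord (ell2_basis n) k = (if k + 1 = n then 1 else 0)"
proof -
  have "summable (\<lambda>k. (if k + 1 = n then 1 else 0 :: real)\<^sup>2)"
    by (rule summable_finite[where N="{..<n}"]) auto
  then show ?thesis unfolding ell2_basis_def by (subst Abs_ell2_inverse) auto
qed

lemma inner_ell2_basis: "n \<ge> 1 \<Longrightarrow> inner x (ell2_basis n) = coord x (n - 1)"
proof -
  assume n: "n \<ge> 1"
  have "inner x (ell2_basis n) = (\<Sum>k\<in>{n - 1}. coord x k * coord (ell2_basis n) k)"
    unfolding inner_ell2_def by (rule suminf_finite) (auto simp: coord_ell2_basis)
  then show ?thesis using n by (simp add: coord_ell2_basis)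
qed


definition op_graph :: "('a \<Rightarrow> 'b set) \<Rightarrow> ('a \<times> 'b) set" where
  "op_graph A = {(x, y). y \<in> A x}"

definition single_valued_op :: "('a \<Rightarrow> 'b) \<Rightarrow> 'a \<Rightarrow> 'b set" where
  "single_valued_op F x = {F x}"

definition monotone_op :: "('a::real_inner \<Rightarrow> 'a set) \<Rightarrow> bool" where
  "monotone_op A \<longleftrightarrow>
    (\<forall>(x1, y1) \<in> op_graph A. \<forall>(x2, y2) \<in> op_graph A. inner (y1 - y2) (x1 - x2) \<ge> 0)"

definition maximally_monotone_op :: "('a::real_inner \<Rightarrow> 'a set) \<Rightarrow> bool" where
  "maximally_monotone_op A \<longleftrightarrow>
    monotone_op A \<and> \<not> (\<exists>A'. monotone_op A' \<and> op_graph A \<subset> op_graph A')"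

text \<open>Sequences of operators are indexed by m = 1, 2, ...; the value at index 0 is never used.\<close>

definition outer_limit :: "(nat \<Rightarrow> 'a::real_inner \<Rightarrow> 'a set) \<Rightarrow> ('a \<times> 'a) set" where
  "outer_limit A = {(x, y). \<exists>m xs ys. strict_mono m \<and>
      (\<forall>k. m k \<ge> 1 \<and> (xs k, ys k) \<in> op_graph (A (m k))) \<and> xs \<longlonglongrightarrow> x \<and> ys \<longlonglongrightarrow> y}"

definition inner_limit :: "(nat \<Rightarrow> 'a::real_inner \<Rightarrow> 'a set) \<Rightarrow> ('a \<times> 'a) set" where
  "inner_limit A = {(x, y). \<exists>xs ys.
      (\<forall>\<^sub>F m in sequentially. (xs m, ys m) \<in> op_graph (A m)) \<and> xs \<longlonglongrightarrow> x \<and> ys \<longlonglongrightarrow> y}"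

definition graphical_limit ::
    "(nat \<Rightarrow> 'a::real_inner \<Rightarrow> 'a set) \<Rightarrow> ('a \<Rightarrow> 'a set) \<Rightarrow> bool" where
  "graphical_limit Am A \<longleftrightarrow> op_graph A = outer_limit Am \<and> op_graph A = inner_limit Am"


definition f :: "nat \<Rightarrow> real \<Rightarrow> real" where
  "f n t =
    (if t \<le> 2 powi (- int n - 1) \<or> t \<ge> 2 powi (- int n + 2) then 0
     else if t \<le> 2 powi (- int n) then 2 * (t - 2 powi (- int n - 1))
     else if t \<le> 2 powi (- int n + 1) then 2 powi (- int n)
     else (1 / 2) * (2 powi (- int n + 2) - t))"

text \<open>The series over n = 1, 2, ... is written over \<open>Suc n\<close> for n = 0, 1, ...\<close>

definition T :: "ell2 \<Rightarrow> ell2" where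
  "T x = (\<Sum>n. f (Suc n) (norm x) *\<^sub>R ell2_basis (Suc n))"

definition B :: "real \<Rightarrow> ell2 \<Rightarrow> ell2" where
  "B \<alpha> x = x + \<alpha> *\<^sub>R T x"

definition B_resc :: "real \<Rightarrow> nat \<Rightarrow> ell2 \<Rightarrow> ell2" where
  "B_resc \<alpha> m x = real m *\<^sub>R B \<alpha> (x /\<^sub>R real m)"

text \<open>For \<open>\<alpha> = 0\<close> the rescaled operators are all the identity, whose constant sequence does not
  converge graphically to the operator with graph \<open>{(0, 0)}\<close>.\<close>

lemma not_graphical_limit_if_zero:
  assumes "op_graph Z = {(0, 0)}"
  shows "\<not> graphical_limit (\<lambda>m. single_valued_op (B_resc 0 m)) Z"
proof
  assume lim: "graphical_limit (\<lambda>m. single_valued_op (B_resc 0 m)) Z"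
  let ?e = "ell2_basis 1"
  have "\<forall>\<^sub>F m in sequentially. (?e, ?e) \<in> op_graph (single_valued_op (B_resc 0 m))"
    using eventually_gt_at_top[of 0]
    by eventually_elim (simp add: op_graph_def single_valued_op_def B_resc_def B_def)
  then have "(?e, ?e) \<in> inner_limit (\<lambda>m. single_valued_op (B_resc 0 m))"
    unfolding inner_limit_def mem_Collect_eq prod.case
    by (intro exI[of _ "\<lambda>_. ?e"] conjI tendsto_const)
  then have "(?e, ?e) \<in> op_graph Z" using lim unfolding graphical_limit_def by blast
  then have "?e = 0" by (simp add: assms)
  moreover have "coord ?e 0 = 1" by (simp add: coord_ell2_basis)
  ultimately show False by simp
qed

end

theory Submission
  imports Defs
begin

text \<open>Write \<open>Q c = min t c - min s c\<close> for \<open>s \<le> t\<close>. Increments of the functions \<open>f n\<close> are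
  combinations of differences of values of \<open>Q\<close> at consecutive powers of 2. These differences are
  nonnegative and telescope to at most \<open>t - s\<close>, so \<open>T\<close> is Lipschitz with constant
  \<open>sqrt 17 / 2\<close>. Hence the rescaled operators are the identity plus a nonexpansive map, thus
  monotone and continuous, thus maximally monotone.
  For the graphical limit, \<open>norm (T u) \<ge> norm u / 2\<close> near the origin, while every fixed
  coordinate of \<open>T u\<close> vanishes for \<open>u\<close> small. So if \<open>xs k\<close> and \<open>m k *\<^sub>R T (xs k /\<^sub>R m k)\<close>
  converge with \<open>m k\<close> unbounded, the second limit is 0, and then so is the first.\<close>

section \<open>Monotone operators\<close>

lemma mem_op_graph_single [simp]: "(x, y) \<in> op_graph (single_valued_op F) \<longleftrightarrow> y = F x"
  by (simp add: op_graph_def single_valued_op_def)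

text \<open>Minty's trick: a point \<open>(u, v)\<close> of a monotone extension is tested against
  graph points over \<open>u\<close> moved slightly in the direction \<open>v - F u\<close>.
  Continuity lets the shift tend to 0.\<close>

lemma maximally_monotone_single_valued:
  fixes F :: "'a::real_inner \<Rightarrow> 'a"
  assumes cont: "continuous_on UNIV F"
    and mono: "\<And>x y. inner (F x - F y) (x - y) \<ge> 0"
  shows "maximally_monotone_op (single_valued_op F)"
proof -
  have "v = F u"
    if A: "monotone_op A" "op_graph (single_valued_op F) \<subseteq> op_graph A" and uv: "(u, v) \<in> op_graph A"
    for A u v
  proof -
    have ge: "inner (v - F z) (u - z) \<ge> 0" for z
    proof -
      have "(z, F z) \<in> op_graph A" using A(2) by auto
      with A(1) uv show ?thesis unfolding monotone_op_def by fastforce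
    qed
    \<comment> \<open>With this direction, \<open>u - g n\<close> is a positive multiple of
      \<open>w\<close>. The multiple cancels, and the limiting inequality reads
      \<open>- inner w w \<ge> 0\<close>.\<close>
    define w where "w = F u - v"
    define g where "g = (\<lambda>n. u - inverse (real (Suc n)) *\<^sub>R w)"
    have "g \<longlonglongrightarrow> u - 0 *\<^sub>R w"
      unfolding g_def by (intro tendsto_intros LIMSEQ_inverse_real_of_nat)
    then have "(\<lambda>n. F (g n)) \<longlonglongrightarrow> F u"
      using cont by (intro continuous_on_tendsto_compose[OF cont]) auto
    then have lim: "(\<lambda>n. inner (v - F (g n)) w) \<longlonglongrightarrow> inner (v - F u) w"
      by (intro tendsto_intros)
    have "inner (v - F (g n)) w \<ge> 0" for n
      using ge[of "g n"] by (simp add: g_def zero_le_mult_iff)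
    then have "inner (v - F u) w \<ge> 0"
      by (intro LIMSEQ_le_const[OF lim]) auto
    moreover have "inner (v - F u) w = - inner w w"
      by (simp add: w_def flip: inner_minus_left)
    ultimately have "w = 0"
      by (metis inner_ge_zero inner_eq_zero_iff neg_0_le_iff_le order_antisym)
    then show ?thesis by (simp add: w_def)
  qed
  then have "op_graph A \<subseteq> op_graph (single_valued_op F)"
    if "monotone_op A" "op_graph (single_valued_op F) \<subseteq> op_graph A" for A
    using that by force
  moreover have "monotone_op (single_valued_op F)"
    by (auto simp: monotone_op_def mono)
  ultimately show ?thesis
    unfolding maximally_monotone_op_def by blast
qed

lemma maximally_monotone_id_plus_nonexpansive:
  fixes G :: "'a::real_inner \<Rightarrow> 'a"
  assumes G: "\<And>x y. norm (G x - G y) \<le> norm (x - y)"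
  shows "maximally_monotone_op (single_valued_op (\<lambda>x. x + G x))"
proof (rule maximally_monotone_single_valued)
  have "1-lipschitz_on UNIV G"
    by (rule lipschitz_onI) (simp_all add: dist_norm G)
  then have "continuous_on UNIV G" by (rule lipschitz_on_continuous_on)
  then show "continuous_on UNIV (\<lambda>x. x + G x)"
    by (intro continuous_intros)
  fix x y :: 'a
  have "\<bar>inner (G x - G y) (x - y)\<bar> \<le> norm (G x - G y) * norm (x - y)"
    by (rule Cauchy_Schwarz_ineq2)
  also have "\<dots> \<le> norm (x - y) * norm (x - y)"
    by (intro mult_right_mono G) simp
  also have "\<dots> = inner (x - y) (x - y)"
    by (simp add: power2_norm_eq_inner flip: power2_eq_square)
  finally have "inner (x - y) (x - y) + inner (G x - G y) (x - y) \<ge> 0" by linarith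
  then show "inner (x + G x - (y + G y)) (x - y) \<ge> 0"
    by (simp add: inner_add_left inner_diff_left)
qed

lemma inner_limit_subset_outer_limit: "inner_limit A \<subseteq> outer_limit A"
proof clarify
  fix x y assume "(x, y) \<in> inner_limit A"
  then obtain xs ys N where *: "\<And>m. m \<ge> N \<Longrightarrow> (xs m, ys m) \<in> op_graph (A m)"
      "xs \<longlonglongrightarrow> x" "ys \<longlonglongrightarrow> y"
    by (auto simp: inner_limit_def eventually_sequentially)
  \<comment> \<open>Shifting by \<open>Suc N\<close> instead of \<open>N\<close> keeps all indices
    at least 1, as \<open>outer_limit\<close> demands.\<close>
  have "strict_mono (\<lambda>k. k + Suc N)" by (simp add: strict_mono_def)
  moreover have "(\<lambda>k. xs (k + Suc N)) \<longlonglongrightarrow> x" "(\<lambda>k. ys (k + Suc N)) \<longlonglongrightarrow> y"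
    using * by (auto intro!: LIMSEQ_ignore_initial_segment simp del: add_Suc_right)
  moreover have "k + Suc N \<ge> 1 \<and> (xs (k + Suc N), ys (k + Suc N)) \<in> op_graph (A (k + Suc N))" for k
    by (simp add: *)
  ultimately show "(x, y) \<in> outer_limit A"
    unfolding outer_limit_def mem_Collect_eq prod.case
    by (intro exI[of _ "\<lambda>k. k + Suc N"] exI[of _ "\<lambda>k. xs (k + Suc N)"]
        exI[of _ "\<lambda>k. ys (k + Suc N)"]) simp
qed

section \<open>The functions \<open>f\<close> and the operator \<open>T\<close>\<close>

text \<open>For \<open>b \<le> a\<close>, \<open>min t a - min t b\<close> is a ramp that rises with
  slope 1 on the interval from \<open>b\<close> to \<open>a\<close> and is constant elsewhere. The
  trapezoid is one ramp with slope 2 minus a later one with slope 1/2. Writing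
  \<open>2 * (1/2) ^ j\<close> avoids a negative exponent at \<open>j = 0\<close>.\<close>

lemma f_Suc_eq_min:
  "f (Suc j) t = 2 * (min t ((1/2) ^ Suc j) - min t ((1/2) ^ Suc (Suc j)))
    - (1/2) * (min t (2 * (1/2) ^ j) - min t (2 * (1/2) ^ Suc j))"
proof -
  define d :: real where "d = (1/2) ^ j"
  have "d > 0" by (simp add: d_def)
  have powi: "2 powi (- int j) = d"
    by (simp add: d_def power_int_minus power_one_over inverse_eq_divide)
  have powis: "2 powi (- int (Suc j) - 1) = d / 4" "2 powi (- int (Suc j) + 2) = 2 * d"
    "2 powi (- int (Suc j)) = d / 2" "2 powi (- int (Suc j) + 1) = d"
    unfolding powi[symmetric] by (simp_all add: power_int_diff power_int_add power_int_minus inverse_eq_divide)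
  show ?thesis
    using \<open>d > 0\<close> unfolding f_def powis power_Suc d_def[symmetric]
    by (auto simp: min_def field_simps)
qed

lemma f_Suc_eq_0:
  assumes "t \<le> (1/2) ^ (j + 2)"
  shows "f (Suc j) t = 0"
proof -
  define d :: real where "d = (1/2) ^ j"
  have "d > 0" by (simp add: d_def)
  moreover have "t \<le> d / 4" using assms by (simp add: d_def)
  ultimately show ?thesis
    by (simp add: f_Suc_eq_min min_def flip: d_def)
qed

text \<open>The constant is \<open>2\<^sup>2 + (1/2)\<^sup>2\<close>, from the slopes of the two
  ramps; each family of ramp increments has total at most \<open>t - s\<close>.\<close>

lemma f_Suc_increments:
  fixes s t :: real
  assumes st: "s \<le> t"
  shows "(\<Sum>j<N. (f (Suc j) t - f (Suc j) s)\<^sup>2) \<le> 17 / 4 * (t - s)\<^sup>2"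
proof -
  define Q where "Q c = min t c - min s c" for c
  define a where "a j = Q ((1/2) ^ Suc j) - Q ((1/2) ^ Suc (Suc j))" for j
  define b where "b j = Q (2 * (1/2) ^ j) - Q (2 * (1/2) ^ Suc j)" for j
  have Q: "0 \<le> Q c" "Q c \<le> t - s" "c \<le> c' \<Longrightarrow> Q c \<le> Q c'" for c c'
    using st by (auto simp: Q_def min_def)
  have Q_diff: "Q c - Q c' \<le> t - s" for c c' using Q(1)[of c'] Q(2)[of c] by linarith
  have a: "0 \<le> a j" "a j \<le> t - s" and b: "0 \<le> b j" "b j \<le> t - s" for j
    by (simp_all only: a_def b_def Q_diff) (simp_all add: Q)
  have "(f (Suc j) t - f (Suc j) s)\<^sup>2 \<le> (t - s) * (4 * a j + b j / 4)" for j
  proof -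
    have "f (Suc j) t - f (Suc j) s = 2 * a j - b j / 2"
      unfolding f_Suc_eq_min a_def b_def Q_def by (simp add: field_simps)
    then have "(f (Suc j) t - f (Suc j) s)\<^sup>2
        = 4 * (a j * a j) + (b j * b j) / 4 - 2 * (a j * b j)"
      by (simp only:) (simp add: power2_eq_square algebra_simps)
    moreover have "a j * a j \<le> (t - s) * a j" "b j * b j \<le> (t - s) * b j" "0 \<le> a j * b j"
      using a[of j] b[of j] by (auto intro: mult_right_mono)
    moreover have "(t - s) * (4 * a j + b j / 4) = 4 * ((t - s) * a j) + (t - s) * b j / 4"
      by (simp add: distrib_left)
    ultimately show ?thesis by linarith
  qed
  then have "(\<Sum>j<N. (f (Suc j) t - f (Suc j) s)\<^sup>2) \<le> (\<Sum>j<N. (t - s) * (4 * a j + b j / 4))"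
    by (rule sum_mono)
  also have "\<dots> = (t - s) * (4 * sum a {..<N} + sum b {..<N} / 4)"
    by (simp add: sum.distrib flip: sum_distrib_left sum_divide_distrib)
  also have "\<dots> \<le> (t - s) * (4 * (t - s) + (t - s) / 4)"
  proof -
    have "sum a {..<N} \<le> t - s" "sum b {..<N} \<le> t - s"
      unfolding a_def b_def
      using sum_lessThan_telescope'[of "\<lambda>j. Q ((1/2) ^ Suc j)" N]
        sum_lessThan_telescope'[of "\<lambda>j. Q (2 * (1/2) ^ j)" N]
      by (simp_all only: Q_diff)
    then show ?thesis using st by (intro mult_left_mono add_mono divide_right_mono) auto
  qed
  also have "\<dots> = 17 / 4 * (t - s)\<^sup>2"
    by (simp add: power2_eq_square field_simps)
  finally show ?thesis .
qed

text \<open>For the least \<open>n\<close> with \<open>(1/2) ^ n \<le> t\<close>, the point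
  \<open>t\<close> lies on the plateau of \<open>f n\<close>, whose height \<open>(1/2) ^ n\<close>
  exceeds \<open>t / 2\<close>. The bound \<open>t < 1\<close> excludes \<open>n = 0\<close>, where
  no plateau is available.\<close>

lemma f_Suc_lower_bound:
  assumes "0 < t" "t < 1"
  obtains j where "t / 2 \<le> f (Suc j) t"
proof -
  obtain n where "(1/2) ^ n < t" using real_arch_pow_inv[OF assms(1), of "1/2"] by auto
  then have ex: "\<exists>n. (1/2) ^ n \<le> t" by (auto intro: less_imp_le)
  define n where "n = (LEAST n. (1/2) ^ n \<le> t)"
  have n: "(1/2) ^ n \<le> t" unfolding n_def using ex by (rule LeastI_ex)
  then have "n \<noteq> 0" using assms(2) by (cases n) auto
  then obtain j where j: "n = Suc j" by (cases n) auto
  have "t < (1/2) ^ j" using not_less_Least[of j "\<lambda>n. (1/2) ^ n \<le> t"] by (simp flip: n_def add: j)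
  with n show ?thesis by (intro that[of j]) (auto simp: f_Suc_eq_min min_def j)
qed

lemma coord_sum: "coord (sum g A) k = (\<Sum>n\<in>A. coord (g n) k)"
  by (induction A rule: infinite_finite_induct) auto

text \<open>The series is a finite sum: all terms vanish if \<open>norm x = 0\<close>, and otherwise
  the supports of \<open>f (Suc n)\<close> eventually lie below \<open>norm x\<close>.\<close>

lemma coord_T: "coord (T x) k = f (Suc k) (norm x)"
proof -
  have "\<exists>N. \<forall>n\<ge>N. f (Suc n) (norm x) = 0"
  proof (cases "norm x = 0")
    case True
    then show ?thesis by (simp add: f_Suc_eq_0)
  next
    case False
    then have "norm x / 2 > 0" by simp
    then obtain N where N: "(1/2) ^ N < norm x / 2"
      using real_arch_pow_inv[of "norm x / 2" "1/2"] by auto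
    have "f (Suc n) (norm x) = 0" if "n \<ge> N" for n
    proof -
      define d :: real where "d = (1/2) ^ n"
      have "d > 0" by (simp add: d_def)
      have "d \<le> (1/2) ^ N" unfolding d_def using that by (rule power_decreasing) auto
      with N have "2 * d < norm x" by linarith
      with \<open>d > 0\<close> show ?thesis by (simp add: f_Suc_eq_min min_def flip: d_def)
    qed
    then show ?thesis by blast
  qed
  then obtain N where N: "\<And>n. n \<ge> N \<Longrightarrow> f (Suc n) (norm x) = 0" by blast
  \<comment> \<open>The maximum keeps the term with index \<open>k\<close> inside the range even
    when \<open>N \<le> k\<close>.\<close>
  have "T x = (\<Sum>n<max N (Suc k). f (Suc n) (norm x) *\<^sub>R ell2_basis (Suc n))"
    unfolding T_def by (rule suminf_finite) (auto simp: N not_less)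
  then show ?thesis
    by (simp add: coord_sum coord_ell2_basis if_distrib[of "\<lambda>x. _ * x"] cong: if_cong)
qed

lemma T_zero [simp]: "T 0 = 0"
  by (rule ell2_eqI) (simp add: coord_T f_Suc_eq_0)

text \<open>\<open>T\<close> depends on the norm alone, so the scalar increment bound and the
  reverse triangle inequality suffice.\<close>

lemma T_lipschitz: "norm (T x - T y) \<le> sqrt 17 / 2 * norm (x - y)"
proof -
  have le: "norm (T x - T y) \<le> sqrt 17 / 2 * norm (x - y)" if "norm y \<le> norm x" for x y
  proof (rule power2_le_imp_le)
    have "(norm (T x - T y))\<^sup>2 \<le> 17 / 4 * (norm x - norm y)\<^sup>2"
      unfolding norm_ell2_sq using f_Suc_increments[OF that]
      by (intro suminf_le_const summable_coord_sq) (simp add: coord_T)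
    also have "\<dots> \<le> 17 / 4 * (norm (x - y))\<^sup>2"
      using that norm_triangle_ineq2[of x y] by (intro mult_left_mono power_mono) auto
    finally show "(norm (T x - T y))\<^sup>2 \<le> (sqrt 17 / 2 * norm (x - y))\<^sup>2"
      by (simp add: power_mult_distrib power_divide)
  qed simp
  show ?thesis
    using le[of x y] le[of y x] by (cases "norm y \<le> norm x") (auto simp: norm_minus_commute)
qed

lemma norm_T_ge:
  assumes "norm x < 1"
  shows "norm x / 2 \<le> norm (T x)"
proof (cases "x = 0")
  case False
  then obtain j where "norm x / 2 \<le> f (Suc j) (norm x)"
    using f_Suc_lower_bound[of "norm x"] assms by auto
  then show ?thesis using abs_coord_le_norm[of "T x" j] by (simp add: coord_T)
qed simp

section \<open>Rescaling\<close>

lemma B_resc_eq: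
  "m \<ge> 1 \<Longrightarrow> B_resc \<alpha> m x = x + (\<alpha> * real m) *\<^sub>R T (x /\<^sub>R real m)"
  by (simp add: B_resc_def B_def scaleR_add_right mult.commute)

text \<open>The scaling by \<open>m\<close> outside \<open>T\<close> cancels the one inside, and
  \<open>2 / sqrt 17\<close> is the reciprocal of the Lipschitz constant of
  \<open>T\<close>.\<close>

lemma maximally_monotone_B_resc:
  assumes alpha: "\<bar>\<alpha>\<bar> \<le> 2 / sqrt 17" and m: "m \<ge> 1"
  shows "maximally_monotone_op (single_valued_op (B_resc \<alpha> m))"
proof -
  define G where "G x = (\<alpha> * real m) *\<^sub>R T (x /\<^sub>R real m)" for x
  have "norm (G x - G y) \<le> norm (x - y)" for x y
  proof -
    have "norm (G x - G y) = \<bar>\<alpha>\<bar> * (real m * norm (T (x /\<^sub>R real m) - T (y /\<^sub>R real m)))"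
      by (simp add: G_def abs_mult flip: scaleR_diff_right)
    also have "\<dots> \<le> (2 / sqrt 17) * (real m * (sqrt 17 / 2 * norm (x /\<^sub>R real m - y /\<^sub>R real m)))"
      using alpha by (intro mult_mono T_lipschitz) auto
    also have "\<dots> = norm (x - y)"
      using m by (simp flip: scaleR_diff_right)
    finally show ?thesis .
  qed
  then have "maximally_monotone_op (single_valued_op (\<lambda>x. x + G x))"
    by (rule maximally_monotone_id_plus_nonexpansive)
  moreover have "B_resc \<alpha> m = (\<lambda>x. x + G x)"
    using m by (simp add: fun_eq_iff B_resc_eq G_def)
  ultimately show ?thesis by simp
qed

section \<open>Limits of the rescaled graphs\<close>

lemma tendsto_coord: "(\<lambda>k. coord (z k) j) \<longlonglongrightarrow> coord l j" if "z \<longlonglongrightarrow> l"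
proof -
  have "(\<lambda>k. inner (z k) (ell2_basis (Suc j))) \<longlonglongrightarrow> inner l (ell2_basis (Suc j))"
    using that by (intro tendsto_intros)
  then show ?thesis by (simp add: inner_ell2_basis)
qed

lemma rescaled_T_limits_zero:
  fixes r :: "nat \<Rightarrow> real"
  assumes r: "filterlim r at_top sequentially"
    and x: "xs \<longlonglongrightarrow> x"
    and z: "(\<lambda>k. r k *\<^sub>R T (xs k /\<^sub>R r k)) \<longlonglongrightarrow> z"
  shows "x = 0" and "z = 0"
proof -
  have "(\<lambda>k. norm (xs k) * inverse (r k)) \<longlonglongrightarrow> norm x * 0"
    by (intro tendsto_intros x filterlim_compose[OF tendsto_inverse_0_at_top r] tendsto_inverse_0_at_top r)
  moreover have "\<forall>\<^sub>F k in sequentially. r k > 0"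
    using r by (simp add: filterlim_at_top_dense)
  ultimately have small: "\<forall>\<^sub>F k in sequentially. norm (xs k /\<^sub>R r k) < e \<and> r k > 0" if "e > 0" for e
    using that by (auto dest!: order_tendstoD(2) elim: eventually_elim2 simp: mult.commute)
  \<comment> \<open>The rescaled radius eventually drops below \<open>(1/2) ^ (j + 2)\<close>, the
    left end of the support of \<open>f (Suc j)\<close>.\<close>
  have "coord z j = 0" for j
  proof (rule LIMSEQ_unique[OF tendsto_coord[OF z]], rule tendsto_eventually)
    show "\<forall>\<^sub>F k in sequentially. coord (r k *\<^sub>R T (xs k /\<^sub>R r k)) j = 0"
      using small[of "(1/2) ^ (j + 2)"]
      by (rule eventually_mono) (simp_all add: coord_T f_Suc_eq_0 del: norm_scaleR power_Suc)
  qed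
  then show "z = 0" by (intro ell2_eqI) simp
  \<comment> \<open>The lower bound on \<open>T\<close> is homogeneous of degree 1, so it survives
    the rescaling and passes to the limit.\<close>
  have "\<forall>\<^sub>F k in sequentially. norm (xs k) / 2 \<le> norm (r k *\<^sub>R T (xs k /\<^sub>R r k))"
    using small[of 1, OF zero_less_one]
  proof eventually_elim
    case (elim k)
    then have "r k > 0" by simp
    have "norm (xs k) = r k * norm (xs k /\<^sub>R r k)" using \<open>r k > 0\<close> by simp
    moreover have "r k * (norm (xs k /\<^sub>R r k) / 2) \<le> r k * norm (T (xs k /\<^sub>R r k))"
      using elim by (intro mult_left_mono norm_T_ge) auto
    moreover have "norm (r k *\<^sub>R T (xs k /\<^sub>R r k)) = r k * norm (T (xs k /\<^sub>R r k))"
      using \<open>r k > 0\<close> by simp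
    ultimately show ?case by linarith
  qed
  then have "norm x / 2 \<le> norm z"
    by (intro tendsto_le[OF _ tendsto_norm[OF z] tendsto_divide[OF tendsto_norm[OF x] tendsto_const]])
      auto
  then show "x = 0" using \<open>z = 0\<close> by simp
qed

lemma outer_limit_B_resc:
  assumes "\<alpha> \<noteq> 0"
  shows "outer_limit (\<lambda>m. single_valued_op (B_resc \<alpha> m)) \<subseteq> {(0, 0)}"
proof clarify
  fix x y assume "(x, y) \<in> outer_limit (\<lambda>m. single_valued_op (B_resc \<alpha> m))"
  then obtain m xs ys where m: "strict_mono m" "\<And>k. m k \<ge> 1"
    and ys: "\<And>k. ys k = B_resc \<alpha> (m k) (xs k)"
    and lim: "xs \<longlonglongrightarrow> x" "ys \<longlonglongrightarrow> y"
    by (auto simp: outer_limit_def)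
  \<comment> \<open>Isolating the \<open>T\<close> part divides by \<open>\<alpha>\<close>, hence
    the assumption \<open>\<alpha> \<noteq> 0\<close>.\<close>
  have "real (m k) *\<^sub>R T (xs k /\<^sub>R real (m k)) = (ys k - xs k) /\<^sub>R \<alpha>" for k
    using m(2)[of k] assms by (simp add: ys B_resc_eq)
  moreover have "(\<lambda>k. (ys k - xs k) /\<^sub>R \<alpha>) \<longlonglongrightarrow> (y - x) /\<^sub>R \<alpha>"
    by (intro tendsto_intros lim)
  ultimately have z: "(\<lambda>k. real (m k) *\<^sub>R T (xs k /\<^sub>R real (m k))) \<longlonglongrightarrow> (y - x) /\<^sub>R \<alpha>" by simp
  have "filterlim (\<lambda>k. real (m k)) at_top sequentially"
    by (intro filterlim_compose[OF filterlim_real_sequentially] filterlim_subseq m)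
  from rescaled_T_limits_zero[OF this lim(1) z] show "x = 0 \<and> y = 0"
    using assms by simp
qed

lemma zero_mem_inner_limit_B_resc:
  "(0, 0) \<in> inner_limit (\<lambda>m. single_valued_op (B_resc \<alpha> m))"
  unfolding inner_limit_def mem_Collect_eq prod.case
  by (intro exI[of _ "\<lambda>_. 0"]) (simp add: B_resc_def B_def)

theorem theorem2:
  fixes \<alpha> :: real and Z :: "ell2 \<Rightarrow> ell2 set"
  assumes "\<bar>\<alpha>\<bar> \<le> 2 / sqrt 17"
    and "\<alpha> \<noteq> 0"
    and "op_graph Z = {(0, 0)}"
  shows "(\<forall>m\<ge>1. maximally_monotone_op (single_valued_op (B_resc \<alpha> m)) \<and>
      (\<forall>x. B_resc \<alpha> m x = x + (\<alpha> * real m) *\<^sub>R T (x /\<^sub>R real m))) \<and>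
    graphical_limit (\<lambda>m. single_valued_op (B_resc \<alpha> m)) Z"
proof -
  let ?A = "\<lambda>m. single_valued_op (B_resc \<alpha> m)"
  \<comment> \<open>These inclusions form a closed chain through \<open>{(0, 0)}\<close>, so both
    limits equal it.\<close>
  have "outer_limit ?A \<subseteq> {(0, 0)}" "(0, 0) \<in> inner_limit ?A" "inner_limit ?A \<subseteq> outer_limit ?A"
    by (rule outer_limit_B_resc[OF assms(2)] zero_mem_inner_limit_B_resc
        inner_limit_subset_outer_limit)+
  then have "graphical_limit ?A Z"
    unfolding graphical_limit_def assms(3) by blast
  then show ?thesis
    using maximally_monotone_B_resc[OF assms(1)] by (simp add: B_resc_eq)
qed

end
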